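(* Let $G$ be a simple graph and let $v\in V(G)$ be a non-isolated vertex of degree $d(v)$. Then $$ \lambda(G)\leq \sqrt{\lambda(G-v)^2 + 2d(v) - 1}. $$ Moreover, if $G$ is connected and has $n$ vertices, then equality holds if and only if either ($G\cong K_{1,n-1}$ and $d(v)=1$) or $G\cong K_n$.
   Context: Graphs are finite and simple (undirected, no loops or multiple edges). For a graph $H$, $\lambda(H)$ denotes the spectral radius of the adjacency matrix of $H$ (equivalently, its largest eigenvalue). $G-v$ is the graph obtained from $G$ by deleting the vertex $v$ and all edges incident to it. $d(v)$ is the degree of $v$ in $G$; $v$ is non-isolated if $d(v)\geq 1$. $K_n$ is the complete graph on $n$ vertices and $K_{1,n-1}$ is the star on $n$ vertices. *)

theory Defs
  imports
    "Graph_Theory.Graph_Theory"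
    "Jordan_Normal_Form.Spectral_Radius"
begin

text \<open>
  A finite simple graph is a value satisfying the locale predicate \<^locale>\<open>graph\<close>: a finite
  loopfree digraph without parallel arcs whose arc relation is symmetric. Each undirected edge is
  thus a pair of opposite arcs, and the degree of a vertex is its \<^const>\<open>out_degree\<close>.
\<close>

definition adjacency_matrix :: "('a, 'b) pre_digraph \<Rightarrow> 'a list \<Rightarrow> complex mat" where
  "adjacency_matrix G vs =
     mat (length vs) (length vs) (\<lambda>(i, j). if vs ! i \<rightarrow>\<^bsub>G\<^esub> vs ! j then 1 else 0)"

text \<open>
  The spectral radius does not depend on the enumeration of the vertices; see
  \<open>graph_spectral_radius_eq\<close> below. For the graph without vertices the value is
  unspecified.
\<close>

definition graph_spectral_radius :: "('a, 'b) pre_digraph \<Rightarrow> real" where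
  "graph_spectral_radius G =
     spectral_radius (adjacency_matrix G (SOME vs. distinct vs \<and> set vs = verts G))"

lemma eigenvalue_adjacency_matrix_iff:
  assumes "distinct vs"
  shows "eigenvalue (adjacency_matrix G vs) k \<longleftrightarrow>
    (\<exists>f. (\<exists>u\<in>set vs. f u \<noteq> 0) \<and>
         (\<forall>u\<in>set vs. (\<Sum>w\<in>set vs. if u \<rightarrow>\<^bsub>G\<^esub> w then f w else 0) = k * f u))"
    (is "?L \<longleftrightarrow> ?R")
proof -
  let ?n = "length vs"
  let ?A = "adjacency_matrix G vs"
  have bij: "bij_betw (\<lambda>i. vs ! i) {0..<?n} (set vs)"
    using bij_betw_nth[OF assms, of "{0..<?n}" "set vs"] by (simp add: atLeast0LessThan)
  have sum_eq: "(\<Sum>w\<in>set vs. g w) = (\<Sum>j = 0..<?n. g (vs ! j))" for g :: "'a \<Rightarrow> complex"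
    using sum.reindex_bij_betw[OF bij, of g] by simp
  have row: "(?A *\<^sub>v x) $ i = (\<Sum>j = 0..<?n. if vs ! i \<rightarrow>\<^bsub>G\<^esub> vs ! j then x $ j else 0)"
    if "i < ?n" "x \<in> carrier_vec ?n" for i x
    using that by (auto simp: adjacency_matrix_def scalar_prod_def intro!: sum.cong)
  show ?thesis
  proof
    assume ?L
    then obtain x where x: "x \<in> carrier_vec ?n" "x \<noteq> 0\<^sub>v ?n" "?A *\<^sub>v x = k \<cdot>\<^sub>v x"
      by (auto simp: eigenvalue_def eigenvector_def adjacency_matrix_def)
    define f where "f = (\<lambda>u. x $ the_inv_into {0..<?n} (\<lambda>i. vs ! i) u)"
    have f: "f (vs ! i) = x $ i" if "i < ?n" for i
      unfolding f_def using the_inv_into_f_f[OF bij_betw_imp_inj_on[OF bij], of i] that by simp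
    obtain i where i: "i < ?n" "x $ i \<noteq> 0"
      using x(1,2) by (metis carrier_vecD eq_vecI index_zero_vec)
    have "\<exists>u\<in>set vs. f u \<noteq> 0"
      using i f[of i] by (auto intro!: bexI[of _ "vs ! i"])
    moreover have "(\<Sum>w\<in>set vs. if u \<rightarrow>\<^bsub>G\<^esub> w then f w else 0) = k * f u" if "u \<in> set vs" for u
    proof -
      obtain i where i: "i < ?n" "u = vs ! i"
        using \<open>u \<in> set vs\<close> by (metis in_set_conv_nth)
      have "(\<Sum>w\<in>set vs. if u \<rightarrow>\<^bsub>G\<^esub> w then f w else 0) = (?A *\<^sub>v x) $ i"
        unfolding sum_eq row[OF i(1) x(1)] by (rule sum.cong) (auto simp: i f)
      also have "\<dots> = k * f u"
        using x i f by simp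
      finally show ?thesis .
    qed
    ultimately show ?R by blast
  next
    assume ?R
    then obtain f u where f: "u \<in> set vs" "f u \<noteq> 0"
      and eq: "\<And>u. u \<in> set vs \<Longrightarrow> (\<Sum>w\<in>set vs. if u \<rightarrow>\<^bsub>G\<^esub> w then f w else 0) = k * f u"
      by blast
    define x where "x = vec ?n (\<lambda>i. f (vs ! i))"
    obtain i where i: "i < ?n" "u = vs ! i"
      using f(1) by (metis in_set_conv_nth)
    have x: "x \<in> carrier_vec ?n" by (simp add: x_def)
    have "x $ i \<noteq> 0" using i f by (simp add: x_def)
    then have "x \<noteq> 0\<^sub>v ?n" using i by auto
    moreover have "?A *\<^sub>v x = k \<cdot>\<^sub>v x"
    proof (rule eq_vecI)
      fix j assume "j < dim_vec (k \<cdot>\<^sub>v x)"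
      then have j: "j < ?n" by (simp add: x_def)
      have "(?A *\<^sub>v x) $ j = (\<Sum>w\<in>set vs. if vs ! j \<rightarrow>\<^bsub>G\<^esub> w then f w else 0)"
        unfolding sum_eq row[OF j x] by (rule sum.cong) (auto simp: x_def)
      then show "(?A *\<^sub>v x) $ j = (k \<cdot>\<^sub>v x) $ j"
        using eq[of "vs ! j"] j by (simp add: x_def)
    qed (simp add: adjacency_matrix_def x_def)
    ultimately show ?L
      using x by (auto simp: eigenvalue_def eigenvector_def adjacency_matrix_def)
  qed
qed

lemma graph_spectral_radius_eq:
  assumes "distinct vs" "set vs = verts G"
  shows "graph_spectral_radius G = spectral_radius (adjacency_matrix G vs)"
proof -
  define ws where "ws = (SOME vs. distinct vs \<and> set vs = verts G)"
  have ws: "distinct ws \<and> set ws = verts G"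
    unfolding ws_def by (rule someI[of _ vs]) (use assms in simp)
  have "spectrum (adjacency_matrix G ws) = spectrum (adjacency_matrix G vs)"
    using assms ws by (auto simp: spectrum_def eigenvalue_adjacency_matrix_iff)
  then show ?thesis
    by (simp add: graph_spectral_radius_def spectral_radius_def ws_def)
qed

end

theory Submission
  imports Defs "HOL-Analysis.Function_Topology" "HOL-Analysis.Convex"
begin

text \<open>
  Let \<open>l\<close> and \<open>m\<close> be the spectral radii of \<open>G\<close> and \<open>G - v\<close>, let \<open>d\<close> be the degree of \<open>v\<close>, \<open>N\<close> its
  neighbourhood and \<open>W\<close> the set of the vertices outside \<open>N \<union> {v}\<close>. Let \<open>x\<close> be a nonnegative
  eigenvector of \<open>G\<close> for \<open>l\<close>, and put \<open>p = (x v)\<^sup>2\<close>, \<open>S = (\<Sum>u\<in>N. (x u)\<^sup>2)\<close>,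
  \<open>R = (\<Sum>u\<in>W. (x u)\<^sup>2)\<close>. The adjacency operator of \<open>G - v\<close> does not increase norms by more than
  the factor \<open>m\<close>; applied to the restriction of \<open>x\<close> to \<open>N \<union> W\<close> this gives
  \<open>(l\<^sup>2 - m\<^sup>2) * (S + R) \<le> (2 * l\<^sup>2 - d) * p\<close>.
  It remains to see that \<open>p\<close> is small, namely that the right hand side is at most
  \<open>(2 * d - 1) * (S + R)\<close>.

  By the eigenvalue equation at \<open>v\<close> and the Cauchy-Schwarz inequality, \<open>l\<^sup>2 * p \<le> d * S\<close>. If \<open>l < d\<close>,
  this alone is enough, and the resulting inequality is strict. If \<open>l \<ge> d\<close>, then the eigenvalue
  equations on \<open>N\<close> and on \<open>W\<close>, multiplied by \<open>x\<close> and summed, express the defect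
  \<open>(2 * d - 1) * (S + R) - (2 * l\<^sup>2 - d) * p\<close>, up to the positive factor \<open>d * l\<close>, as a combination
  with nonnegative coefficients of
    \<^item> \<open>d * S - l\<^sup>2 * p\<close>,
    \<^item> \<open>p * (d - 1) * (l - d)\<close>,
    \<^item> the sum of \<open>x u * x w\<close> over the ordered pairs of distinct nonadjacent vertices of \<open>N\<close>,
    \<^item> the sum of \<open>x u * x w\<close> over the ordered pairs of adjacent vertices of \<open>W\<close>.

  Both cases are treated in \<open>deleted_vertex_bound\<close>. If \<open>G\<close> is connected, then \<open>x\<close> is positive, so
  equality forces \<open>N\<close> to be a clique, \<open>W\<close> to be independent, and \<open>d = 1\<close> or \<open>l = d\<close>. In the first
  case \<open>G\<close> is a star with leaf \<open>v\<close>; in the second, \<open>N \<union> {v}\<close> is a clique with \<open>l + 1\<close> vertices, which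
  no edge can leave (\<open>clique_of_max_size_isolated\<close>), so \<open>G\<close> is complete. Conversely, the spectral radii
  of stars and complete graphs are read off from positive eigenvectors
  (\<open>graph_spectral_radius_eqI\<close>).

  The spectral radius is defined by complex eigenvalues. It is related to norms and to nonnegative
  eigenvectors by \<open>Perron_vector_symmetric_kernel\<close>, which maximises the norm of the image over the
  unit sphere.
\<close>

section \<open>Perron vectors of symmetric nonnegative kernels\<close>

lemma unit_sphere_attains_max_image_norm:
  fixes a :: "'a \<Rightarrow> 'a \<Rightarrow> real"
  assumes fin: "finite V" and ne: "V \<noteq> {}"
  shows "\<exists>M y. 0 \<le> M \<and> (\<Sum>u\<in>V. (y u)\<^sup>2) = 1 \<and> (\<Sum>u\<in>V. (\<Sum>w\<in>V. a u w * y w)\<^sup>2) = M \<and>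
    (\<forall>z. (\<Sum>u\<in>V. (\<Sum>w\<in>V. a u w * z w)\<^sup>2) \<le> M * (\<Sum>u\<in>V. (z u)\<^sup>2))"
proof -
  define q where "q z = (\<Sum>u\<in>V. (\<Sum>w\<in>V. a u w * z w)\<^sup>2)" for z
  define nn where "nn z = (\<Sum>u\<in>V. (z u)\<^sup>2)" for z :: "'a \<Rightarrow> real"
  \<comment> \<open>the unit sphere, with the coordinates outside \<open>V\<close> set to zero to make it compact\<close>
  define K where "K = PiE UNIV (\<lambda>i. if i \<in> V then {-1..1} else {0::real}) \<inter> {z. nn z = 1}"
  have cq: "continuous_on UNIV q" and cn: "continuous_on UNIV nn"
    unfolding q_def nn_def by (intro continuous_intros continuous_on_product_coordinates)+
  have "compactin (product_topology (\<lambda>i. euclidean) UNIV)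
          (PiE UNIV (\<lambda>i. if i \<in> V then {-1..1} else {0::real}))"
    by (subst compactin_PiE) auto
  then have "compact (PiE UNIV (\<lambda>i. if i \<in> V then {-1..1} else {0::real}))"
    by (simp add: euclidean_product_topology)
  moreover have "closed {z. nn z = 1}"
    using continuous_closed_preimage_constant[OF cn closed_UNIV, of 1] by simp
  ultimately have "compact K"
    unfolding K_def by (rule compact_Int_closed)
  moreover obtain v where v: "v \<in> V" using ne by blast
  have "(\<lambda>i. if i = v then 1 else 0) \<in> K"
    using v fin by (auto simp: K_def nn_def if_distrib[of "\<lambda>x. x\<^sup>2"] cong: if_cong)
  ultimately obtain y where y: "y \<in> K" and max: "\<And>z. z \<in> K \<Longrightarrow> q z \<le> q y"
    using continuous_attains_sup[of K q] continuous_on_subset[OF cq] by blast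
  have "q z \<le> q y * nn z" for z
  proof (cases "nn z = 0")
    case True
    then have "\<forall>u\<in>V. z u = 0"
      using fin by (simp add: nn_def sum_nonneg_eq_0_iff)
    then show ?thesis by (simp add: q_def nn_def)
  next
    case False
    have nn: "nn z > 0" using False unfolding nn_def by (simp add: sum_nonneg order_less_le)
    define c where "c = 1 / sqrt (nn z)"
    have c: "c\<^sup>2 * nn z = 1" using nn by (simp add: c_def power_divide)
    define z' where "z' u = (if u \<in> V then c * z u else 0)" for u
    have nz: "nn z' = 1"
      using c by (simp add: nn_def z'_def power_mult_distrib sum_distrib_left)
    have "\<bar>z' u\<bar> \<le> 1" if "u \<in> V" for u
    proof -
      have "(z' u)\<^sup>2 \<le> nn z'" unfolding nn_def using that fin by (intro member_le_sum) auto
      then show ?thesis using nz by (simp add: abs_square_le_1)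
    qed
    then have "z' \<in> K" using nz by (auto simp: K_def z'_def abs_le_iff)
    have "q z' = c\<^sup>2 * q z"
    proof -
      have "(\<Sum>w\<in>V. a u w * z' w) = c * (\<Sum>w\<in>V. a u w * z w)" for u
        by (auto simp: z'_def sum_distrib_left intro!: sum.cong)
      then have "q z' = (\<Sum>u\<in>V. c\<^sup>2 * (\<Sum>w\<in>V. a u w * z w)\<^sup>2)"
        by (simp only: q_def power_mult_distrib)
      then show ?thesis by (simp only: q_def sum_distrib_left)
    qed
    then have "c\<^sup>2 * q z \<le> q y" using max[OF \<open>z' \<in> K\<close>] by simp
    then have "nn z * (c\<^sup>2 * q z) \<le> nn z * q y" using nn by (intro mult_left_mono) auto
    then show ?thesis using c by (metis mult.commute mult.left_commute mult_1)
  qed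
  moreover have "0 \<le> q y" unfolding q_def by (intro sum_nonneg) auto
  moreover have "nn y = 1" using y by (simp add: K_def)
  ultimately show ?thesis unfolding q_def nn_def by blast
qed

text \<open>
  The operator norm \<open>m\<close> of a symmetric nonnegative kernel is an eigenvalue with a nonnegative
  eigenvector. A unit vector \<open>y\<close> that maximises the norm of the image can be taken nonnegative and
  satisfies \<open>A (A y) = m\<^sup>2 y\<close>; since \<open>(A - m) (A + m) y = 0\<close>, the vector \<open>A y + m y\<close> is as required.
\<close>

lemma Perron_vector_symmetric_kernel:
  fixes a :: "'a \<Rightarrow> 'a \<Rightarrow> real"
  assumes fin: "finite V" and ne: "V \<noteq> {}"
    and sym: "\<And>u w. a u w = a w u" and nonneg: "\<And>u w. 0 \<le> a u w"
  obtains m g where "0 \<le> m" "\<And>u. 0 \<le> g u" "\<exists>u\<in>V. g u \<noteq> 0"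
    "\<And>u. u \<in> V \<Longrightarrow> (\<Sum>w\<in>V. a u w * g w) = m * g u"
    "\<And>z. (\<Sum>u\<in>V. (\<Sum>w\<in>V. a u w * z w)\<^sup>2) \<le> m\<^sup>2 * (\<Sum>u\<in>V. (z u)\<^sup>2)"
proof -
  define A where "A z u = (\<Sum>w\<in>V. a u w * z w)" for z u
  obtain M y0 where M: "0 \<le> M" and y0: "(\<Sum>u\<in>V. (y0 u)\<^sup>2) = 1" "(\<Sum>u\<in>V. (A y0 u)\<^sup>2) = M"
    and le: "\<And>z. (\<Sum>u\<in>V. (A z u)\<^sup>2) \<le> M * (\<Sum>u\<in>V. (z u)\<^sup>2)"
    using unit_sphere_attains_max_image_norm[OF fin ne, of a] unfolding A_def by blast
  define y where "y u = \<bar>y0 u\<bar>" for u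
  have y: "0 \<le> y u" for u by (simp add: y_def)
  have yn: "(\<Sum>u\<in>V. (y u)\<^sup>2) = 1" using y0 by (simp add: y_def)
  have Anonneg: "0 \<le> A z u" if "\<And>w. 0 \<le> z w" for z u
    unfolding A_def using nonneg that by (intro sum_nonneg) auto
  have "M \<le> (\<Sum>u\<in>V. (A y u)\<^sup>2)"
    unfolding y0(2)[symmetric]
  proof (rule sum_mono)
    fix u
    have "\<bar>A y0 u\<bar> \<le> (\<Sum>w\<in>V. \<bar>a u w * y0 w\<bar>)" unfolding A_def by (rule sum_abs)
    also have "\<dots> = A y u" by (simp add: A_def y_def abs_mult nonneg)
    finally show "(A y0 u)\<^sup>2 \<le> (A y u)\<^sup>2" by (simp add: abs_le_square_iff[symmetric])
  qed
  with le[of y] yn have yM: "(\<Sum>u\<in>V. (A y u)\<^sup>2) = M" by simp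
  have adj: "(\<Sum>u\<in>V. A z u * z' u) = (\<Sum>u\<in>V. z u * A z' u)" for z z'
  proof -
    have "(\<Sum>u\<in>V. A z u * z' u) = (\<Sum>u\<in>V. \<Sum>w\<in>V. a u w * z w * z' u)"
      by (simp add: A_def sum_distrib_right)
    also have "\<dots> = (\<Sum>w\<in>V. \<Sum>u\<in>V. a u w * z w * z' u)" by (rule sum.swap)
    also have "\<dots> = (\<Sum>w\<in>V. z w * A z' w)"
      by (simp add: A_def sum_distrib_left sym[of _ "_::'a"] mult_ac)
    finally show ?thesis .
  qed
  have AAy: "A (A y) u = M * y u" if u: "u \<in> V" for u
  proof -
    \<comment> \<open>perturbing the maximiser in the direction of the residual would yield a first-order gain
      unless the residual vanishes\<close>
    define r where "r u = A (A y) u - M * y u" for u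
    define P where "P = (\<Sum>u\<in>V. (r u)\<^sup>2)"
    define C where "C = M * P - (\<Sum>u\<in>V. (A r u)\<^sup>2)"
    have key: "0 \<le> t\<^sup>2 * C - 2 * t * P" for t
    proof -
      have "A (\<lambda>u. y u + t * r u) u = A y u + t * A r u" for u
        by (simp add: A_def algebra_simps sum.distrib sum_distrib_left)
      then have "(\<Sum>u\<in>V. (A (\<lambda>u. y u + t * r u) u)\<^sup>2)
         = M + 2 * t * (\<Sum>u\<in>V. A y u * A r u) + t\<^sup>2 * (\<Sum>u\<in>V. (A r u)\<^sup>2)"
        by (simp add: power2_sum power_mult_distrib sum.distrib yM sum_distrib_left mult_ac)
      moreover have "(\<Sum>u\<in>V. (y u + t * r u)\<^sup>2) = 1 + 2 * t * (\<Sum>u\<in>V. y u * r u) + t\<^sup>2 * P"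
        by (simp add: power2_sum power_mult_distrib sum.distrib yn sum_distrib_left mult_ac P_def)
      moreover have "(\<Sum>u\<in>V. A y u * A r u) - M * (\<Sum>u\<in>V. y u * r u) = P"
        using adj[of "A y" r]
        by (simp add: P_def r_def power2_eq_square algebra_simps sum_distrib_left sum_subtractf sum.distrib)
      ultimately show ?thesis
        using le[of "\<lambda>u. y u + t * r u"] by (simp add: C_def algebra_simps)
    qed
    have P0: "0 \<le> P" unfolding P_def by (intro sum_nonneg) auto
    have "P = 0"
    proof (rule ccontr)
      assume "P \<noteq> 0"
      then have P: "P > 0" using P0 by simp
      show False
      proof (cases "C \<le> 0")
        case True with key[of 1] P show False by simp
      next
        case False
        have "(P / C)\<^sup>2 * C - 2 * (P / C) * P = - P\<^sup>2 / C"
          using False by (simp add: field_simps power2_eq_square)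
        also have "\<dots> < 0" using P False by simp
        finally show False using key[of "P / C"] by simp
      qed
    qed
    then have "r u = 0" using fin u by (simp add: P_def sum_nonneg_eq_0_iff)
    then show ?thesis by (simp add: r_def)
  qed
  \<comment> \<open>for \<open>M = 0\<close> the vector \<open>A y + sqrt M * y\<close> vanishes, but then \<open>A y = 0\<close>\<close>
  define g where "g u = (if M = 0 then y u else A y u + sqrt M * y u)" for u
  show ?thesis
  proof (rule that[of "sqrt M" g])
    show "0 \<le> g u" for u using y Anonneg[of y u] M by (simp add: g_def)
    have "\<exists>u\<in>V. y u \<noteq> 0"
    proof (rule ccontr)
      assume "\<not> (\<exists>u\<in>V. y u \<noteq> 0)"
      then have "(\<Sum>u\<in>V. (y u)\<^sup>2) = 0" by simp
      with yn show False by simp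
    qed
    then obtain u where u: "u \<in> V" "y u \<noteq> 0" by blast
    have "0 < y u" using u y[of u] by (simp add: order_less_le)
    then have "0 < A y u + sqrt M * y u" if "M \<noteq> 0"
      using that M y Anonneg[of y u] by (intro add_nonneg_pos mult_pos_pos) auto
    then have "g u \<noteq> 0" using u by (auto simp: g_def)
    then show "\<exists>u\<in>V. g u \<noteq> 0" using u by blast
    show "(\<Sum>w\<in>V. a u w * g w) = sqrt M * g u" if "u \<in> V" for u
    proof (cases "M = 0")
      case True
      then have "A y u = 0" using yM fin that by (simp add: sum_nonneg_eq_0_iff)
      then show ?thesis using True by (simp add: g_def A_def)
    next
      case False
      have "(\<Sum>w\<in>V. a u w * g w) = A (A y) u + sqrt M * A y u"
        using False by (simp add: g_def A_def[of "A y"] A_def[of y u] algebra_simps sum.distrib sum_distrib_left)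
      also have "\<dots> = sqrt M * g u"
        using AAy[OF that] False M by (simp add: g_def algebra_simps flip: mult.assoc)
      finally show ?thesis .
    qed
    show "(\<Sum>u\<in>V. (\<Sum>w\<in>V. a u w * z w)\<^sup>2) \<le> (sqrt M)\<^sup>2 * (\<Sum>u\<in>V. (z u)\<^sup>2)" for z
      using le[of z] M by (simp add: A_def)
  qed (use M in simp)
qed

section \<open>The inequality for a deleted vertex\<close>

text \<open>
  The graph is given by its zero-one kernel \<open>a\<close>. The only property of \<open>m\<close> that is used is that the
  kernel restricted to \<open>V - {v}\<close> increases norms at most by the factor \<open>m\<close>. In the case of equality
  the three conclusions hold for every nonzero nonnegative eigenvector \<open>x\<close>; they say something about
  the graph where \<open>x\<close> is positive.
\<close>

lemma deleted_vertex_bound: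
  fixes a :: "'a \<Rightarrow> 'a \<Rightarrow> real"
  assumes fin: "finite V" and v: "v \<in> V"
    and sym: "\<And>u w. a u w = a w u" and irr: "\<And>u. a u u = 0" and zo: "\<And>u w. a u w \<in> {0, 1}"
    and l0: "0 \<le> l" and x0: "\<And>u. 0 \<le> x u" and xne: "\<exists>u\<in>V. x u \<noteq> 0"
    and eig: "\<And>u. u \<in> V \<Longrightarrow> (\<Sum>w\<in>V. a u w * x w) = l * x u"
    and rad: "\<And>z. (\<Sum>u\<in>V - {v}. (\<Sum>w\<in>V - {v}. a u w * z w)\<^sup>2) \<le> m\<^sup>2 * (\<Sum>u\<in>V - {v}. (z u)\<^sup>2)"
    and N: "N = {w \<in> V. a v w = 1}" "N \<noteq> {}" and d: "d = real (card N)"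
    and W: "W = V - {v} - N"
  shows "l\<^sup>2 \<le> m\<^sup>2 + 2 * d - 1"
    and "l\<^sup>2 = m\<^sup>2 + 2 * d - 1 \<Longrightarrow> (x v)\<^sup>2 * (d - 1) * (l - d) = 0 \<and>
      (\<forall>u\<in>N. \<forall>w\<in>N. u \<noteq> w \<longrightarrow> (1 - a u w) * x u * x w = 0) \<and>
      (\<forall>u\<in>W. \<forall>w\<in>W. a u w * x u * x w = 0)"
proof -
  define p where "p = (x v)\<^sup>2"
  define S where "S = (\<Sum>u\<in>N. (x u)\<^sup>2)"
  define R where "R = (\<Sum>u\<in>W. (x u)\<^sup>2)"
  define T where "T = (\<Sum>u\<in>N. x u)"
  define I where "I = (\<Sum>u\<in>N. \<Sum>w\<in>N. a u w * x u * x w)"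
  define O' where "O' = (\<Sum>u\<in>N. \<Sum>w\<in>W. a u w * x u * x w)"
  define Q where "Q = (\<Sum>u\<in>W. \<Sum>w\<in>W. a u w * x u * x w)"
  define J where "J = (\<Sum>u\<in>N. \<Sum>w\<in>N. (of_bool (u \<noteq> w) - a u w) * x u * x w)"
  have fN: "finite N" and fW: "finite W" using fin N W by auto
  have V': "V - {v} = N \<union> W" "N \<inter> W = {}" using N W irr[of v] by auto
  have V: "V = insert v (N \<union> W)" and vN: "v \<notin> N \<union> W" using V' v by auto
  have sumV': "(\<Sum>u\<in>V - {v}. f u) = (\<Sum>u\<in>N. f u) + (\<Sum>u\<in>W. f u)" for f :: "'a \<Rightarrow> real"
    unfolding V'(1) by (rule sum.union_disjoint[OF fN fW V'(2)])
  have sumV: "(\<Sum>u\<in>V. f u) = f v + (\<Sum>u\<in>N. f u) + (\<Sum>u\<in>W. f u)" for f :: "'a \<Rightarrow> real"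
    using sum.remove[OF fin v, of f] sumV'[of f] by simp
  have avN: "a v u = 1" "a u v = 1" if "u \<in> N" for u using that N sym[of u v] by auto
  have avW: "a v u = 0" "a u v = 0" if "u \<in> W" for u using that N W sym[of u v] zo[of v u] by auto
  have NV: "u \<in> V" if "u \<in> N" for u using that N by simp
  have WV: "u \<in> V" if "u \<in> W" for u using that W by simp
  have T: "T = l * x v"
    using eig[OF v] by (simp add: sumV irr avN avW T_def)
  have eqN: "l * x u = x v + (\<Sum>w\<in>N. a u w * x w) + (\<Sum>w\<in>W. a u w * x w)" if "u \<in> N" for u
    using eig[of u] that NV by (simp add: sumV avN)
  have eqW: "l * x u = (\<Sum>w\<in>N. a u w * x w) + (\<Sum>w\<in>W. a u w * x w)" if "u \<in> W" for u
    using eig[of u] that WV by (simp add: sumV avW)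
  have lS: "l * S = l * p + I + O'"
  proof -
    have "l * S = (\<Sum>u\<in>N. x u * (l * x u))"
      by (simp add: S_def sum_distrib_left power2_eq_square mult_ac)
    also have "\<dots> = (\<Sum>u\<in>N. x u * (x v + (\<Sum>w\<in>N. a u w * x w) + (\<Sum>w\<in>W. a u w * x w)))"
      by (rule sum.cong) (simp_all add: eqN)
    also have "\<dots> = x v * T + I + O'"
      by (simp add: T_def I_def O'_def sum_distrib_left algebra_simps sum.distrib)
    finally show ?thesis by (simp add: T p_def power2_eq_square mult_ac)
  qed
  have lR: "l * R = O' + Q"
  proof -
    have "l * R = (\<Sum>u\<in>W. x u * (l * x u))"
      by (simp add: R_def sum_distrib_left power2_eq_square mult_ac)
    also have "\<dots> = (\<Sum>u\<in>W. x u * ((\<Sum>w\<in>N. a u w * x w) + (\<Sum>w\<in>W. a u w * x w)))"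
      by (rule sum.cong) (simp_all add: eqW)
    also have "\<dots> = (\<Sum>u\<in>W. \<Sum>w\<in>N. a w u * x w * x u) + Q"
      by (simp add: Q_def sum_distrib_left algebra_simps sum.distrib sym[of _ "_::'a"])
    also have "(\<Sum>u\<in>W. \<Sum>w\<in>N. a w u * x w * x u) = O'"
      unfolding O'_def by (rule sum.swap)
    finally show ?thesis .
  qed
  have TT: "T\<^sup>2 = S + I + J"
  proof -
    have "S = (\<Sum>u\<in>N. \<Sum>w\<in>N. of_bool (u = w) * x u * x w)"
      unfolding S_def using fN
      by (intro sum.cong) (simp_all add: power2_eq_square of_bool_def
          if_distribR[of _ "(*) 1" "(*) 0"] if_distrib[of "\<lambda>t. t * _"] cong: if_cong)
    then have "S + I + J = (\<Sum>u\<in>N. \<Sum>w\<in>N. (of_bool (u = w) + a u w + (of_bool (u \<noteq> w) - a u w)) * x u * x w)"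
      by (simp only: I_def J_def sum.distrib[symmetric] distrib_right[symmetric])
    also have "\<dots> = (\<Sum>u\<in>N. \<Sum>w\<in>N. x u * x w)"
      by (intro sum.cong) auto
    also have "\<dots> = T\<^sup>2"
      by (simp add: T_def power2_eq_square sum_product)
    finally show ?thesis by simp
  qed
  have J_term: "0 \<le> (of_bool (u \<noteq> w) - a u w) * x u * x w" for u w
    using zo[of u w] irr[of u] x0[of u] x0[of w] by (cases "u = w") auto
  have Q_term: "0 \<le> a u w * x u * x w" for u w
    using zo[of u w] x0[of u] x0[of w] by auto
  have J0: "0 \<le> J" unfolding J_def by (intro sum_nonneg J_term)
  have Q0: "0 \<le> Q" unfolding Q_def by (intro sum_nonneg Q_term)
  have S0: "0 \<le> S" "0 \<le> R" "0 \<le> p" unfolding S_def R_def p_def by (auto intro: sum_nonneg)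
  have d1: "1 \<le> d" using N(2) fN by (simp add: d Suc_le_eq card_gt_0_iff)
  \<comment> \<open>\<open>T = l * x v\<close> is a sum of \<open>card N\<close> entries\<close>
  have CS: "l\<^sup>2 * p \<le> d * S"
    using Cauchy_Schwarz_ineq_sum[of "\<lambda>_. 1" x N] T
    by (simp add: T_def S_def p_def d power_mult_distrib)
  have Y: "0 < S + R"
  proof (rule ccontr)
    assume "\<not> 0 < S + R"
    then have "S = 0" "R = 0" using S0 by auto
    then have z: "x u = 0" if "u \<in> N \<union> W" for u
      using that fN fW by (auto simp: S_def R_def sum_nonneg_eq_0_iff)
    obtain u where "u \<in> N" using N(2) by blast
    with eqN[of u] z have "x v = 0" by simp
    with z V xne show False by auto
  qed
  \<comment> \<open>off \<open>v\<close>, the restricted kernel maps \<open>x\<close> to \<open>l * x u - a u v * x v\<close>\<close>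
  have main: "(l\<^sup>2 - m\<^sup>2) * (S + R) \<le> (2 * l\<^sup>2 - d) * p"
  proof -
    have "(\<Sum>u\<in>V - {v}. (\<Sum>w\<in>V - {v}. a u w * x w)\<^sup>2) = (\<Sum>u\<in>V - {v}. (l * x u - a u v * x v)\<^sup>2)"
      by (intro sum.cong arg_cong[where f = "\<lambda>t. t\<^sup>2"])
        (use eig sum.remove[OF fin v, of "\<lambda>w. a _ w * x w"] in \<open>auto simp: algebra_simps\<close>)
    also have "\<dots> = (\<Sum>u\<in>N. (l * x u - x v)\<^sup>2) + (\<Sum>u\<in>W. (l * x u)\<^sup>2)"
      by (simp add: sumV' avN avW)
    also have "(\<Sum>u\<in>N. (l * x u - x v)\<^sup>2) = l\<^sup>2 * S - 2 * l * x v * T + d * p"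
    proof -
      have "(\<Sum>u\<in>N. (l * x u - x v)\<^sup>2) = (\<Sum>u\<in>N. l\<^sup>2 * (x u)\<^sup>2 - 2 * l * x v * x u + p)"
        by (intro sum.cong) (simp_all add: power2_diff power_mult_distrib p_def algebra_simps)
      also have "\<dots> = l\<^sup>2 * S - 2 * l * x v * T + d * p"
        unfolding S_def T_def d by (simp add: sum.distrib sum_subtractf sum_distrib_left)
      finally show ?thesis .
    qed
    also have "(\<Sum>u\<in>W. (l * x u)\<^sup>2) = l\<^sup>2 * R"
      by (simp add: power_mult_distrib R_def sum_distrib_left)
    finally have "l\<^sup>2 * S - 2 * l * x v * T + d * p + l\<^sup>2 * R \<le> m\<^sup>2 * (S + R)"
      using rad[of x] by (simp add: sumV' S_def R_def)
    then show ?thesis by (simp add: T p_def power2_eq_square algebra_simps)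
  qed
  have small: "l\<^sup>2 < m\<^sup>2 + 2 * d - 1" if "l < d"
  proof (cases "2 * l\<^sup>2 - d \<le> 0")
    case True
    then have "(2 * l\<^sup>2 - d) * p \<le> 0" using S0 by (simp add: mult_nonpos_nonneg)
    with main Y have "l\<^sup>2 - m\<^sup>2 \<le> 0" by (smt (verit) mult_pos_pos)
    then show ?thesis using d1 by simp
  next
    case False
    then have lp: "0 < l\<^sup>2" using d1 by linarith
    have "l\<^sup>2 * ((l\<^sup>2 - m\<^sup>2) * (S + R)) \<le> l\<^sup>2 * ((2 * l\<^sup>2 - d) * p)"
      using main lp by (intro mult_left_mono) auto
    also have "\<dots> = (2 * l\<^sup>2 - d) * (l\<^sup>2 * p)" by simp
    also have "\<dots> \<le> (2 * l\<^sup>2 - d) * (d * (S + R))"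
    proof (rule mult_left_mono)
      have "0 \<le> d * R" using d1 S0 by simp
      with CS show "l\<^sup>2 * p \<le> d * (S + R)" by (simp add: distrib_left)
    qed (use False in simp)
    finally have "(l\<^sup>2 * (l\<^sup>2 - m\<^sup>2)) * (S + R) \<le> ((2 * l\<^sup>2 - d) * d) * (S + R)"
      by (simp add: mult_ac)
    then have "l\<^sup>2 * (l\<^sup>2 - m\<^sup>2) \<le> (2 * l\<^sup>2 - d) * d" using Y by simp
    also have "\<dots> < l\<^sup>2 * (2 * d - 1)"
    proof -
      have "l\<^sup>2 < d\<^sup>2" using that l0 by (intro power_strict_mono) auto
      then show ?thesis by (simp add: algebra_simps power2_eq_square)
    qed
    finally show ?thesis using lp by simp
  qed
  \<comment> \<open>eliminating \<open>I\<close> and \<open>O'\<close> gives \<open>Q + J = l\<^sup>2 * p - S + l * (R + p - S)\<close>; the claim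
    is then a polynomial identity in \<open>d\<close>, \<open>l\<close>, \<open>p\<close>, \<open>R\<close> and \<open>S\<close>\<close>
  have ident: "d * l * ((2 * d - 1) * (S + R) - (2 * l\<^sup>2 - d) * p) =
    (2 * d - 1) * (2 * l + 1) * (d * S - l\<^sup>2 * p) + l * (2 * l + 1) * (p * (d - 1) * (l - d)) +
    (2 * d - 1) * d * (Q + J)"
  proof -
    have "J = l\<^sup>2 * p - S - (l * S - l * p - (l * R - Q))"
      using TT lS lR by (simp add: T p_def power_mult_distrib)
    then have J: "J = l\<^sup>2 * p - S - l * S + l * p + l * R - Q" by simp
    show ?thesis unfolding J by (simp add: algebra_simps power2_eq_square)
  qed
  have terms: "0 \<le> (2 * d - 1) * (2 * l + 1) * (d * S - l\<^sup>2 * p)"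
      "0 \<le> l * (2 * l + 1) * (p * (d - 1) * (l - d))" "0 \<le> (2 * d - 1) * d * (Q + J)" if "d \<le> l"
    using that d1 l0 S0 CS J0 Q0 by (auto intro!: mult_nonneg_nonneg)
  have large: "(2 * l\<^sup>2 - d) * p \<le> (2 * d - 1) * (S + R)" if "d \<le> l"
  proof -
    have "0 \<le> d * l * ((2 * d - 1) * (S + R) - (2 * l\<^sup>2 - d) * p)"
      unfolding ident using terms[OF that] by linarith
    moreover have "0 < d * l" using d1 that by auto
    ultimately show ?thesis by (simp add: zero_le_mult_iff)
  qed
  show "l\<^sup>2 \<le> m\<^sup>2 + 2 * d - 1"
  proof (cases "l < d")
    case True then show ?thesis using small by simp
  next
    case False
    then have "(l\<^sup>2 - m\<^sup>2) * (S + R) \<le> (2 * d - 1) * (S + R)" using main large by linarith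
    then show ?thesis using Y by simp
  qed
  assume eq: "l\<^sup>2 = m\<^sup>2 + 2 * d - 1"
  then have dl: "d \<le> l" using small by force
  have "(2 * d - 1) * (S + R) \<le> (2 * l\<^sup>2 - d) * p"
  proof -
    have "l\<^sup>2 - m\<^sup>2 = 2 * d - 1" using eq by simp
    then show ?thesis using main by simp
  qed
  with large[OF dl] have "(2 * d - 1) * (S + R) - (2 * l\<^sup>2 - d) * p = 0" by simp
  with ident terms[OF dl] have "l * (2 * l + 1) * (p * (d - 1) * (l - d)) = 0" "(2 * d - 1) * d * (Q + J) = 0"
    by (simp_all del: mult_eq_0_iff)
  then have "p * (d - 1) * (l - d) = 0" "Q + J = 0" using dl d1 by auto
  then have pd: "p * (d - 1) * (l - d) = 0" and "Q = 0" "J = 0" using J0 Q0 by auto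
  have "(1 - a u w) * x u * x w = 0" if "u \<in> N" "w \<in> N" "u \<noteq> w" for u w
  proof -
    have "(of_bool (u \<noteq> w) - a u w) * x u * x w = 0"
      using \<open>J = 0\<close> that(1,2) fN unfolding J_def
      by (simp add: sum_nonneg_eq_0_iff sum_nonneg J_term del: mult_eq_0_iff)
    then show ?thesis using that(3) by simp
  qed
  moreover have "a u w * x u * x w = 0" if "u \<in> W" "w \<in> W" for u w
    using \<open>Q = 0\<close> that fW unfolding Q_def
    by (simp add: sum_nonneg_eq_0_iff sum_nonneg Q_term del: mult_eq_0_iff)
  ultimately show "(x v)\<^sup>2 * (d - 1) * (l - d) = 0 \<and>
      (\<forall>u\<in>N. \<forall>w\<in>N. u \<noteq> w \<longrightarrow> (1 - a u w) * x u * x w = 0) \<and>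
      (\<forall>u\<in>W. \<forall>w\<in>W. a u w * x u * x w = 0)"
    using pd unfolding p_def by blast
qed

section \<open>The adjacency operator of a graph\<close>

text \<open>
  The adjacency matrix as a real zero-one kernel indexed by the vertices themselves, which avoids
  an enumeration of the vertices.
\<close>

definition adj :: "('a, 'b) pre_digraph \<Rightarrow> 'a \<Rightarrow> 'a \<Rightarrow> real" where
  "adj G u w = of_bool (u \<rightarrow>\<^bsub>G\<^esub> w)"

lemma adj_zero_one: "adj G u w \<in> {0, 1}"
  by (simp add: adj_def)

lemma adj_nonneg: "0 \<le> adj G u w"
  by (simp add: adj_def)

lemma (in graph) adj_sym: "adj G u w = adj G w u"
  using arcs_ends_symmetric[OF sym_arcs] by (auto simp: adj_def)

lemma (in graph) adj_irrefl: "adj G u u = 0"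
  using adj_not_same by (auto simp: adj_def)

text \<open>
  The norm of the adjacency operator dominates every complex eigenvalue, by the triangle inequality
  applied to the moduli of the entries of an eigenvector, and it is itself an eigenvalue; hence it is
  the spectral radius.
\<close>

lemma (in graph)
  assumes ne: "verts G \<noteq> {}"
  shows graph_spectral_radius_nonneg: "0 \<le> graph_spectral_radius G"
    and adj_image_norm_le: "\<And>z. (\<Sum>u\<in>verts G. (\<Sum>w\<in>verts G. adj G u w * z w)\<^sup>2)
       \<le> (graph_spectral_radius G)\<^sup>2 * (\<Sum>u\<in>verts G. (z u)\<^sup>2)"
    and graph_Perron_vector: "\<exists>g. (\<forall>u. 0 \<le> g u) \<and> (\<exists>u\<in>verts G. g u \<noteq> 0) \<and>
      (\<forall>u\<in>verts G. (\<Sum>w\<in>verts G. adj G u w * g w) = graph_spectral_radius G * g u)"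
proof -
  let ?V = "verts G"
  obtain vs where vs: "distinct vs" "set vs = ?V"
    using finite_distinct_list[OF finite_verts] by blast
  let ?A = "adjacency_matrix G vs"
  have A: "?A \<in> carrier_mat (length vs) (length vs)" by (simp add: adjacency_matrix_def)
  have n: "length vs > 0" using vs ne by auto
  have ev: "eigenvalue ?A k \<longleftrightarrow> (\<exists>f. (\<exists>u\<in>?V. f u \<noteq> 0) \<and>
         (\<forall>u\<in>?V. (\<Sum>w\<in>?V. of_real (adj G u w) * f w) = k * f u))" for k
  proof -
    have "(if u \<rightarrow> w then f w else 0) = of_real (adj G u w) * f w" for u w and f :: "'a \<Rightarrow> complex"
      by (simp add: adj_def)
    then show ?thesis
      using eigenvalue_adjacency_matrix_iff[OF vs(1), of G k] by (simp add: vs(2))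
  qed
  obtain m g where m: "0 \<le> m" and g: "\<And>u. 0 \<le> g u" "\<exists>u\<in>?V. g u \<noteq> 0"
    "\<And>u. u \<in> ?V \<Longrightarrow> (\<Sum>w\<in>?V. adj G u w * g w) = m * g u"
    and le: "\<And>z. (\<Sum>u\<in>?V. (\<Sum>w\<in>?V. adj G u w * z w)\<^sup>2) \<le> m\<^sup>2 * (\<Sum>u\<in>?V. (z u)\<^sup>2)"
    by (rule Perron_vector_symmetric_kernel[of ?V "adj G", OF finite_verts ne adj_sym adj_nonneg])
      (rule that)
  have "(\<Sum>w\<in>?V. complex_of_real (adj G u w) * of_real (g w)) = of_real m * of_real (g u)"
    if "u \<in> ?V" for u
    using arg_cong[OF g(3)[OF that], of complex_of_real] by simp
  then have "eigenvalue ?A (of_real m)"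
    unfolding ev using g(2) by (intro exI[of _ "\<lambda>u. of_real (g u)"]) auto
  then have "m \<in> norm ` spectrum ?A"
    using m by (auto simp: spectrum_def intro!: image_eqI[of _ _ "of_real m"])
  then have 1: "m \<le> spectral_radius ?A"
    by (rule spectral_radius_mem_max(2)[OF A n])
  obtain k where k: "eigenvalue ?A k" "spectral_radius ?A = cmod k"
    using spectral_radius_mem_max(1)[OF A n] by (auto simp: spectrum_def)
  then obtain f where f: "\<exists>u\<in>?V. f u \<noteq> 0"
    "\<And>u. u \<in> ?V \<Longrightarrow> (\<Sum>w\<in>?V. of_real (adj G u w) * f w) = k * f u"
    unfolding ev by blast
  have "(\<Sum>u\<in>?V. (cmod k * cmod (f u))\<^sup>2) \<le> (\<Sum>u\<in>?V. (\<Sum>w\<in>?V. adj G u w * cmod (f w))\<^sup>2)"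
  proof (intro sum_mono power_mono)
    fix u assume "u \<in> ?V"
    then have "cmod k * cmod (f u) = cmod (\<Sum>w\<in>?V. of_real (adj G u w) * f w)"
      by (simp add: f(2) norm_mult)
    also have "\<dots> \<le> (\<Sum>w\<in>?V. cmod (of_real (adj G u w) * f w))" by (rule norm_sum)
    also have "\<dots> = (\<Sum>w\<in>?V. adj G u w * cmod (f w))"
      by (intro sum.cong) (auto simp: norm_mult adj_def)
    finally show "cmod k * cmod (f u) \<le> (\<Sum>w\<in>?V. adj G u w * cmod (f w))" .
  qed simp
  also have "\<dots> \<le> m\<^sup>2 * (\<Sum>u\<in>?V. (cmod (f u))\<^sup>2)" by (rule le)
  finally have "(cmod k)\<^sup>2 * (\<Sum>u\<in>?V. (cmod (f u))\<^sup>2) \<le> m\<^sup>2 * (\<Sum>u\<in>?V. (cmod (f u))\<^sup>2)"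
    by (simp add: power_mult_distrib sum_distrib_left)
  moreover have "0 < (\<Sum>u\<in>?V. (cmod (f u))\<^sup>2)"
  proof -
    obtain u where u: "u \<in> ?V" "f u \<noteq> 0" using f(1) by blast
    then show ?thesis using finite_verts by (intro sum_pos2[of _ u]) auto
  qed
  ultimately have "(cmod k)\<^sup>2 \<le> m\<^sup>2" by simp
  then have "cmod k \<le> m" using m by (rule power2_le_imp_le)
  with 1 k have r: "graph_spectral_radius G = m"
    using graph_spectral_radius_eq[OF vs] by simp
  show "0 \<le> graph_spectral_radius G" unfolding r by (rule m)
  show "(\<Sum>u\<in>?V. (\<Sum>w\<in>?V. adj G u w * z w)\<^sup>2)
      \<le> (graph_spectral_radius G)\<^sup>2 * (\<Sum>u\<in>?V. (z u)\<^sup>2)" for z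
    unfolding r by (rule le)
  show "\<exists>g. (\<forall>u. 0 \<le> g u) \<and> (\<exists>u\<in>?V. g u \<noteq> 0) \<and>
      (\<forall>u\<in>?V. (\<Sum>w\<in>?V. adj G u w * g w) = graph_spectral_radius G * g u)"
    unfolding r using g by blast
qed

text \<open>
  A positive eigenvector is not orthogonal to a Perron vector, so it belongs to the same eigenvalue.
\<close>

lemma (in graph) graph_spectral_radius_eqI:
  assumes ne: "verts G \<noteq> {}" and pos: "\<And>u. u \<in> verts G \<Longrightarrow> 0 < f u"
    and eig: "\<And>u. u \<in> verts G \<Longrightarrow> (\<Sum>w\<in>verts G. adj G u w * f w) = k * f u"
  shows "graph_spectral_radius G = k"
proof -
  let ?V = "verts G"
  obtain g where g: "\<And>u. 0 \<le> g u" "\<exists>u\<in>?V. g u \<noteq> 0"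
    "\<And>u. u \<in> ?V \<Longrightarrow> (\<Sum>w\<in>?V. adj G u w * g w) = graph_spectral_radius G * g u"
    using graph_Perron_vector[OF ne] by blast
  have "k * (\<Sum>u\<in>?V. f u * g u) = (\<Sum>u\<in>?V. (\<Sum>w\<in>?V. adj G u w * f w) * g u)"
    unfolding sum_distrib_left by (intro sum.cong) (simp_all add: eig mult.assoc)
  also have "\<dots> = (\<Sum>u\<in>?V. \<Sum>w\<in>?V. adj G u w * f w * g u)"
    by (simp add: sum_distrib_right)
  also have "\<dots> = (\<Sum>w\<in>?V. \<Sum>u\<in>?V. adj G u w * f w * g u)" by (rule sum.swap)
  also have "\<dots> = (\<Sum>w\<in>?V. f w * (\<Sum>u\<in>?V. adj G w u * g u))"
    by (simp add: sum_distrib_left adj_sym[of _ "_::'a"] mult_ac)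
  also have "\<dots> = graph_spectral_radius G * (\<Sum>u\<in>?V. f u * g u)"
    unfolding sum_distrib_left[of "graph_spectral_radius G"]
    by (intro sum.cong) (simp_all add: g(3) mult.left_commute)
  finally have "k * (\<Sum>u\<in>?V. f u * g u) = graph_spectral_radius G * (\<Sum>u\<in>?V. f u * g u)" .
  moreover have "0 < (\<Sum>u\<in>?V. f u * g u)"
  proof -
    obtain u where u: "u \<in> ?V" "g u \<noteq> 0" using g(2) by blast
    then have "0 < f u * g u" using pos[of u] g(1)[of u] by (simp add: order_less_le)
    then show ?thesis
      using u finite_verts pos g(1) by (intro sum_pos2[of _ u]) (auto simp: less_imp_le)
  qed
  ultimately show ?thesis by simp
qed

section \<open>Complete graphs, stars and vertex deletion\<close>

lemma (in graph) complete_graph_spectral_radius: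
  assumes ne: "verts G \<noteq> {}"
    and E: "arcs_ends G = {(u, w). (u, w) \<in> verts G \<times> verts G \<and> u \<noteq> w}"
  shows "graph_spectral_radius G = real (card (verts G)) - 1"
proof (rule graph_spectral_radius_eqI[OF ne, of "\<lambda>_. 1"])
  fix u assume u: "u \<in> verts G"
  have "(\<Sum>w\<in>verts G. adj G u w) = (\<Sum>w\<in>verts G - {u}. adj G u w)"
    using sum.remove[OF finite_verts u, of "adj G u"] by (simp add: adj_irrefl)
  also have "\<dots> = (\<Sum>w\<in>verts G - {u}. 1)"
    using u by (intro sum.cong) (auto simp: adj_def E)
  also have "\<dots> = real (card (verts G)) - 1"
    using u by (simp add: of_nat_diff card_gt_0_iff Suc_le_eq ne)
  finally show "(\<Sum>w\<in>verts G. adj G u w * 1) = (real (card (verts G)) - 1) * 1" by simp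
qed simp

lemma (in graph) star_graph_spectral_radius:
  assumes V: "verts G = insert c L" "c \<notin> L" and E: "arcs_ends G = {c} \<times> L \<union> L \<times> {c}"
  shows "graph_spectral_radius G = sqrt (real (card L))"
proof -
  have fin: "finite L" using finite_verts V by simp
  \<comment> \<open>the entry at the centre must be positive also in the star with a single vertex\<close>
  define f where "f u = (if u = c \<and> L \<noteq> {} then sqrt (real (card L)) else 1)" for u
  show ?thesis
  proof (rule graph_spectral_radius_eqI[of f])
    fix u assume u: "u \<in> verts G"
    show "0 < f u" using fin by (simp add: f_def card_gt_0_iff)
    have split: "(\<Sum>w\<in>verts G. adj G u w * f w) = adj G u c * f c + (\<Sum>w\<in>L. adj G u w * f w)"
      using V fin by simp
    show "(\<Sum>w\<in>verts G. adj G u w * f w) = sqrt (real (card L)) * f u"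
    proof (cases "u = c")
      case True
      have "(\<Sum>w\<in>L. adj G u w * f w) = (\<Sum>w\<in>L. 1)"
        using True V by (intro sum.cong) (auto simp: adj_def E f_def)
      then show ?thesis unfolding split using True by (auto simp: adj_irrefl f_def)
    next
      case False
      then have "u \<in> L" using u V by simp
      have "(\<Sum>w\<in>L. adj G u w * f w) = 0"
        using False V by (intro sum.neutral) (auto simp: adj_def E)
      then show ?thesis using \<open>u \<in> L\<close> False V unfolding split by (auto simp: adj_def E f_def)
    qed
  qed (use V in simp)
qed

lemma (in wf_digraph) arcs_ends_del_vert:
  "arcs_ends (pre_digraph.del_vert G v) = {(u, w). u \<rightarrow>\<^bsub>G\<^esub> w \<and> u \<noteq> v \<and> w \<noteq> v}"
  by (auto simp: arcs_ends_conv del_vert_simps)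

lemma (in graph) graph_del_vert: "graph (del_vert v)"
proof -
  interpret D: fin_digraph "del_vert v" by (rule fin_digraph_del_vert)
  show ?thesis
  proof unfold_locales
    show "symmetric (del_vert v)"
      using arcs_ends_symmetric[OF sym_arcs] by (auto simp: symmetric_def arcs_ends_del_vert intro!: symI)
  qed (auto simp: del_vert_simps ends_del_vert no_loops intro: no_multi_arcs)
qed

lemma (in graph) card_neighbours: "card {w \<in> verts G. adj G v w = 1} = out_degree G v"
proof -
  have "{w \<in> verts G. adj G v w = 1} = head G ` out_arcs G v"
    by (auto simp: adj_def arcs_ends_conv)
  moreover have "inj_on (head G) (out_arcs G v)"
    by (auto intro!: inj_onI no_multi_arcs simp: arc_to_ends_def)
  ultimately show ?thesis by (simp add: card_image out_degree_def)
qed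

section \<open>Connected graphs and positive eigenvectors\<close>

lemma (in graph) connected_closed_eq_verts:
  assumes "connected G" "A \<subseteq> verts G" "A \<noteq> {}" "\<And>u w. u \<in> A \<Longrightarrow> u \<rightarrow> w \<Longrightarrow> w \<in> A"
  shows "A = verts G"
proof -
  obtain u where u: "u \<in> A" using assms(3) by blast
  have "w \<in> A" if "w \<in> verts G" for w
  proof -
    have "u \<rightarrow>\<^sup>* w"
      using symmetric_connected_imp_strongly_connected[OF sym_arcs assms(1)] u assms(2) that
      by (auto simp: strongly_connected_def)
    then show ?thesis unfolding reachable_def
      by (induction rule: rtrancl_on_induct) (use u assms(4) in auto)
  qed
  then show ?thesis using assms(2) by blast
qed

lemma (in graph) connected_eigenvector_pos:
  assumes con: "connected G" and nonneg: "\<And>u. 0 \<le> x u" and ne: "\<exists>u\<in>verts G. x u \<noteq> 0"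
    and eig: "\<And>u. u \<in> verts G \<Longrightarrow> (\<Sum>w\<in>verts G. adj G u w * x w) = k * x u"
    and u: "u \<in> verts G"
  shows "0 < x u"
proof (rule ccontr)
  assume "\<not> 0 < x u"
  then have "x u = 0" using nonneg[of u] by simp
  have "{u \<in> verts G. x u = 0} = verts G"
  proof (rule connected_closed_eq_verts[OF con])
    fix u w assume u: "u \<in> {u \<in> verts G. x u = 0}" and uw: "u \<rightarrow> w"
    then have w: "w \<in> verts G" by (simp add: adj_in_verts)
    have "(\<Sum>w\<in>verts G. adj G u w * x w) = 0" using eig[of u] u by simp
    then have "adj G u w * x w = 0"
      using w finite_verts nonneg by (subst (asm) sum_nonneg_eq_0_iff) (auto simp: adj_def)
    then show "w \<in> {u \<in> verts G. x u = 0}" using uw w by (simp add: adj_def)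
  qed (use u \<open>x u = 0\<close> in auto)
  then show False using ne by auto
qed

text \<open>
  Summing the eigenvalue equations over a clique \<open>C\<close> with \<open>k + 1\<close> vertices, the contributions from
  inside \<open>C\<close> already account for the right hand side, so an edge that leaves \<open>C\<close> would make the
  left hand side too large.
\<close>

lemma (in graph) clique_of_max_size_isolated:
  assumes pos: "\<And>u. u \<in> verts G \<Longrightarrow> 0 < x u"
    and eig: "\<And>u. u \<in> verts G \<Longrightarrow> (\<Sum>w\<in>verts G. adj G u w * x w) = k * x u"
    and C: "C \<subseteq> verts G" "real (card C) = k + 1"
      "\<And>u w. u \<in> C \<Longrightarrow> w \<in> C \<Longrightarrow> u \<noteq> w \<Longrightarrow> u \<rightarrow> w"
    and u: "u \<in> C" "u \<rightarrow> w"
  shows "w \<in> C"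
proof (rule ccontr)
  assume w: "w \<notin> C"
  let ?V = "verts G"
  have fC: "finite C" using C finite_verts finite_subset by blast
  have deg: "(\<Sum>u\<in>C. adj G u z) = k" if z: "z \<in> C" for z
  proof -
    have "(\<Sum>u\<in>C. adj G u z) = (\<Sum>u\<in>C - {z}. adj G u z)"
      using sum.remove[OF fC z, of "\<lambda>u. adj G u z"] by (simp add: adj_irrefl)
    also have "\<dots> = (\<Sum>u\<in>C - {z}. 1)" using z C by (intro sum.cong) (auto simp: adj_def)
    also have "\<dots> = k" using card.remove[OF fC z] C(2) by simp
    finally show ?thesis .
  qed
  have "(\<Sum>u\<in>C. k * x u) = (\<Sum>u\<in>C. \<Sum>z\<in>?V. adj G u z * x z)"
    using eig C by (intro sum.cong) auto
  also have "\<dots> = (\<Sum>z\<in>?V. \<Sum>u\<in>C. adj G u z * x z)" by (rule sum.swap)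
  also have "\<dots> = (\<Sum>z\<in>?V - C. \<Sum>u\<in>C. adj G u z * x z) + (\<Sum>z\<in>C. \<Sum>u\<in>C. adj G u z * x z)"
    by (rule sum.subset_diff[OF C(1) finite_verts])
  also have "(\<Sum>z\<in>C. \<Sum>u\<in>C. adj G u z * x z) = (\<Sum>z\<in>C. k * x z)"
    by (intro sum.cong) (simp_all add: deg flip: sum_distrib_right)
  finally have "(\<Sum>z\<in>?V - C. \<Sum>u\<in>C. adj G u z * x z) = 0" by simp
  moreover have "0 < (\<Sum>z\<in>?V - C. \<Sum>u\<in>C. adj G u z * x z)"
  proof -
    have wV: "w \<in> ?V" using u by (simp add: adj_in_verts)
    have nn: "0 \<le> adj G a z * x z" if "z \<in> ?V" for a z
      using pos[OF that] by (simp add: adj_def)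
    have "0 < (\<Sum>u\<in>C. adj G u w * x w)"
      using fC u wV pos nn by (intro sum_pos2[of _ u]) (auto simp: adj_def)
    then show ?thesis
    proof (intro sum_pos2[of "?V - C" w])
      show "0 \<le> (\<Sum>u\<in>C. adj G u z * x z)" if "z \<in> ?V - C" for z
        using that nn by (intro sum_nonneg) auto
    qed (use wV w finite_verts in auto)
  qed
  ultimately show False by simp
qed

section \<open>The bound and its equality case\<close>

theorem theorem1:
  fixes G :: "('a, 'b) pre_digraph" and v :: 'a and n :: nat
  assumes "graph G" and "v \<in> verts G" and "out_degree G v \<ge> 1"
  shows "graph_spectral_radius G \<le>
           sqrt ((graph_spectral_radius (pre_digraph.del_vert G v))\<^sup>2 + 2 * real (out_degree G v) - 1)
    \<and> (Digraph_Component.connected G \<and> card (verts G) = n \<longrightarrow>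
        (graph_spectral_radius G =
           sqrt ((graph_spectral_radius (pre_digraph.del_vert G v))\<^sup>2 + 2 * real (out_degree G v) - 1)
         \<longleftrightarrow> (complete_bipartite_digraph 1 (n - 1) G \<and> out_degree G v = 1) \<or> complete_digraph n G))"
proof -
  interpret graph G by (rule assms(1))
  interpret D: graph "del_vert v" by (rule graph_del_vert)
  let ?V = "verts G"
  define l where "l = graph_spectral_radius G"
  define m where "m = graph_spectral_radius (del_vert v)"
  define d where "d = out_degree G v"
  define N where "N = {w \<in> ?V. adj G v w = 1}"
  define W where "W = ?V - {v} - N"
  have v: "v \<in> ?V" and d1: "1 \<le> d" using assms by (simp_all add: d_def)
  have cN: "card N = d" unfolding N_def d_def by (rule card_neighbours)
  then have N0: "N \<noteq> {}" using d1 by auto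
  have fN: "finite N" by (simp add: N_def)
  have vN: "v \<notin> N" by (simp add: N_def adj_irrefl)
  have DV: "verts (del_vert v) = ?V - {v}" by (simp add: verts_del_vert)
  have DV0: "verts (del_vert v) \<noteq> {}" using N0 vN by (auto simp: DV N_def)
  obtain x where x: "\<And>u. 0 \<le> x u" "\<exists>u\<in>?V. x u \<noteq> 0"
    and eig: "\<And>u. u \<in> ?V \<Longrightarrow> (\<Sum>w\<in>?V. adj G u w * x w) = l * x u"
    using graph_Perron_vector v unfolding l_def by blast
  have l0: "0 \<le> l"
    using graph_spectral_radius_nonneg v unfolding l_def by blast
  have adjD: "adj (del_vert v) u w = adj G u w" if "u \<noteq> v" "w \<noteq> v" for u w
    using that by (simp add: adj_def arcs_ends_del_vert)
  have rad: "(\<Sum>u\<in>?V - {v}. (\<Sum>w\<in>?V - {v}. adj G u w * z w)\<^sup>2) \<le> m\<^sup>2 * (\<Sum>u\<in>?V - {v}. (z u)\<^sup>2)" for z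
  proof -
    have "(\<Sum>u\<in>?V - {v}. (\<Sum>w\<in>?V - {v}. adj (del_vert v) u w * z w)\<^sup>2) \<le> m\<^sup>2 * (\<Sum>u\<in>?V - {v}. (z u)\<^sup>2)"
      using D.adj_image_norm_le[OF DV0, of z] unfolding m_def DV .
    then show ?thesis by (simp add: adjD)
  qed
  note bound = deleted_vertex_bound[OF finite_verts v adj_sym adj_irrefl adj_zero_one l0 x eig rad
      N_def N0 refl W_def, unfolded cN]
  have le: "l \<le> sqrt (m\<^sup>2 + 2 * real d - 1)"
    using bound(1) by (rule real_le_rsqrt)
  have "l = sqrt (m\<^sup>2 + 2 * real d - 1) \<longleftrightarrow>
      complete_bipartite_digraph 1 (n - 1) G \<and> d = 1 \<or> complete_digraph n G" (is "?eq \<longleftrightarrow> ?star \<or> ?complete")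
    if con: "Digraph_Component.connected G" and n: "card ?V = n"
  proof
    assume ?eq
    moreover have "0 \<le> m\<^sup>2 + 2 * real d - 1"
      using d1 zero_le_power2[of m] by linarith
    ultimately have sq: "l\<^sup>2 = m\<^sup>2 + 2 * real d - 1" by simp
    have eq: "(x v)\<^sup>2 * (real d - 1) * (l - real d) = 0 \<and>
        (\<forall>u\<in>N. \<forall>w\<in>N. u \<noteq> w \<longrightarrow> (1 - adj G u w) * x u * x w = 0) \<and>
        (\<forall>u\<in>W. \<forall>w\<in>W. adj G u w * x u * x w = 0)"
      by (rule bound(2)[OF _ sq])
    have pos: "0 < x u" if "u \<in> ?V" for u
      by (rule connected_eigenvector_pos[OF con x eig that])
    have clique: "u \<rightarrow>\<^bsub>G\<^esub> w" if "u \<in> N" "w \<in> N" "u \<noteq> w" for u w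
      using eq that pos[of u] pos[of w] by (fastforce simp: N_def adj_def split: if_splits)
    have indep: "\<not> u \<rightarrow>\<^bsub>G\<^esub> w" if "u \<in> W" "w \<in> W" for u w
      using eq that pos[of u] pos[of w] by (fastforce simp: W_def adj_def split: if_splits)
    have "d = 1 \<or> l = d" using eq pos[OF v] by auto
    then show "?star \<or> ?complete"
    proof
      assume "d = 1"
      then obtain c where c: "N = {c}" using cN by (metis card_1_singletonE)
      have cV: "c \<in> ?V" using c by (auto simp: N_def)
      have vE: "w = c" if "v \<rightarrow>\<^bsub>G\<^esub> w \<or> w \<rightarrow>\<^bsub>G\<^esub> v" for w
      proof -
        have "v \<rightarrow>\<^bsub>G\<^esub> w" using that arcs_ends_symmetric[OF sym_arcs] by blast
        then have "w \<in> N" by (simp add: N_def adj_def adj_in_verts)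
        then show ?thesis using c by simp
      qed
      have arc: "u = c \<or> w = c" if "u \<rightarrow>\<^bsub>G\<^esub> w" for u w
        using that indep[of u w] vE by (auto simp: W_def c adj_in_verts)
      have sym: "w \<rightarrow>\<^bsub>G\<^esub> u" if "u \<rightarrow>\<^bsub>G\<^esub> w" for u w using that arcs_ends_symmetric[OF sym_arcs] by blast
      have "insert c {w. c \<rightarrow>\<^bsub>G\<^esub> w} = ?V"
      proof (rule connected_closed_eq_verts[OF con])
        show "w \<in> insert c {w. c \<rightarrow>\<^bsub>G\<^esub> w}" if "u \<in> insert c {w. c \<rightarrow>\<^bsub>G\<^esub> w}" "u \<rightarrow>\<^bsub>G\<^esub> w" for u w
          using that arc by blast
      qed (auto simp: cV adj_in_verts)
      then have leaf: "c \<rightarrow>\<^bsub>G\<^esub> w" if "w \<in> ?V" "w \<noteq> c" for w using that by blast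
      have E: "arcs_ends G = {c} \<times> (?V - {c}) \<union> (?V - {c}) \<times> {c}"
      proof (intro equalityI subrelI)
        fix u w assume uw: "u \<rightarrow>\<^bsub>G\<^esub> w"
        then have "u \<noteq> w" using adj_not_same by blast
        then show "(u, w) \<in> {c} \<times> (?V - {c}) \<union> (?V - {c}) \<times> {c}"
          using arc[OF uw] adj_in_verts[OF uw] by auto
      next
        fix u w assume "(u, w) \<in> {c} \<times> (?V - {c}) \<union> (?V - {c}) \<times> {c}"
        then have "u = c \<and> c \<rightarrow>\<^bsub>G\<^esub> w \<or> w = c \<and> c \<rightarrow>\<^bsub>G\<^esub> u" using leaf by blast
        then show "u \<rightarrow>\<^bsub>G\<^esub> w" using sym by blast
      qed
      have UV: "?V = {c} \<union> (?V - {c})" "{c} \<inter> (?V - {c}) = {}" "card {c} = 1" "card (?V - {c}) = n - 1"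
        using cV n by auto
      have "complete_bipartite_digraph 1 (n - 1) G"
        unfolding complete_bipartite_digraph_def using assms(1) UV E by blast
      with \<open>d = 1\<close> show ?thesis by blast
    next
      assume ld: "l = d"
      have cl: "u \<rightarrow>\<^bsub>G\<^esub> w" if "u \<in> insert v N" "w \<in> insert v N" "u \<noteq> w" for u w
      proof -
        have "v \<rightarrow>\<^bsub>G\<^esub> z" "z \<rightarrow>\<^bsub>G\<^esub> v" if "z \<in> N" for z
          using that arcs_ends_symmetric[OF sym_arcs, of v z] by (simp_all add: N_def adj_def)
        then show ?thesis using that clique by blast
      qed
      have "insert v N = ?V"
      proof (rule connected_closed_eq_verts[OF con])
        show "w \<in> insert v N" if "u \<in> insert v N" "u \<rightarrow>\<^bsub>G\<^esub> w" for u w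
        proof (rule clique_of_max_size_isolated[OF pos eig _ _ cl that])
          show "insert v N \<subseteq> ?V" using v by (auto simp: N_def)
          show "real (card (insert v N)) = l + 1" using vN fN cN ld by simp
        qed
      qed (use v in \<open>auto simp: N_def\<close>)
      then have VC: "u \<in> insert v N \<longleftrightarrow> u \<in> ?V" for u by simp
      have "arcs_ends G = {(u, w). (u, w) \<in> ?V \<times> ?V \<and> u \<noteq> w}"
      proof (intro equalityI subrelI)
        fix u w assume uw: "u \<rightarrow>\<^bsub>G\<^esub> w"
        then have "u \<noteq> w" using adj_not_same by blast
        then show "(u, w) \<in> {(u, w). (u, w) \<in> ?V \<times> ?V \<and> u \<noteq> w}"
          using adj_in_verts[OF uw] by simp
      next
        fix u w assume "(u, w) \<in> {(u, w). (u, w) \<in> ?V \<times> ?V \<and> u \<noteq> w}"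
        then show "u \<rightarrow>\<^bsub>G\<^esub> w" using cl unfolding VC by simp
      qed
      then show ?thesis using assms(1) n by (simp add: complete_digraph_def)
    qed
  next
    assume "?star \<or> ?complete"
    then show ?eq
    proof
      assume star: ?star
      then obtain U L where UL: "?V = U \<union> L" "U \<inter> L = {}" "card U = 1" "card L = n - 1"
        "arcs_ends G = U \<times> L \<union> L \<times> U" by (auto simp: complete_bipartite_digraph_def)
      then obtain c where "U = {c}" by (metis card_1_singletonE)
      \<comment> \<open>for the star with two vertices either vertex can serve as the centre\<close>
      obtain c L where c: "?V = insert c L" "c \<notin> L" "arcs_ends G = {c} \<times> L \<union> L \<times> {c}" "v \<in> L"
      proof (cases "v = c")
        case False
        then show ?thesis using that[of c L] UL \<open>U = {c}\<close> v by auto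
      next
        case True
        have "N = L" using True UL \<open>U = {c}\<close> by (auto simp: N_def adj_def)
        then obtain w where "L = {w}" using star cN by (metis card_1_singletonE)
        then show ?thesis using that[of w "{c}"] UL \<open>U = {c}\<close> True by auto
      qed
      have fL: "finite L" using c finite_verts by (metis finite_insert)
      have l: "l = sqrt (card L)"
        unfolding l_def by (rule star_graph_spectral_radius[OF c(1-3)])
      have "m = sqrt (card (L - {v}))"
        unfolding m_def by (rule D.star_graph_spectral_radius[of c]) (use c in \<open>auto simp: DV arcs_ends_del_vert\<close>)
      moreover have "real (card (L - {v})) = real (card L) - 1"
        using card.remove[OF fL c(4)] by simp
      ultimately have "m\<^sup>2 = real (card L) - 1" by (metis of_nat_0_le_iff real_sqrt_pow2)
      then show ?thesis using l star by simp
    next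
      assume ?complete
      then have E: "arcs_ends G = {(u, w). (u, w) \<in> ?V \<times> ?V \<and> u \<noteq> w}"
        by (simp add: complete_digraph_def)
      have n0: "1 \<le> card ?V" using v finite_verts by (auto simp: Suc_le_eq card_gt_0_iff)
      have l: "l = real (card ?V) - 1"
        unfolding l_def by (rule complete_graph_spectral_radius) (use v E in auto)
      have "m = real (card (?V - {v})) - 1"
        unfolding m_def DV[symmetric]
        by (rule D.complete_graph_spectral_radius[OF DV0]) (use E in \<open>auto simp: DV arcs_ends_del_vert\<close>)
      then have m: "m = real (card ?V) - 2" using v n0 by (simp add: of_nat_diff)
      have "N = ?V - {v}" using E v by (auto simp: N_def adj_def)
      then have d: "real d = real (card ?V) - 1" using cN v n0 by (simp add: of_nat_diff flip: cN)
      have "m\<^sup>2 + 2 * real d - 1 = l\<^sup>2" by (simp add: l m d power2_eq_square algebra_simps)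
      then show ?thesis using l0 by simp
    qed
  qed
  with le show ?thesis unfolding l_def m_def d_def by blast
qed

end
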